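(* Let $\mathcal{H}$ be a complex separable Hilbert space and let $\{f_n\}_{n=1}^{\infty}$ be a Schauder basis of $\mathcal{H}$ with basis constant $M$. For $k,l\in\mathbb{N}$ let $$\theta_{kl}=\arccos\frac{|(f_k,f_l)|}{\|f_k\|\cdot\|f_l\|}$$ be the angle between $f_k$ and $f_l$. Then the angles between any two distinct vectors of the basis have a positive lower bound, i.e. there is $\theta_0>0$ with $\theta_{kl}\ge\theta_0$ for all $k\neq l$. In fact, $$\theta_{kl}\ \ge\ \arccos\Bigl(1-\frac{1}{8M^{2}}\Bigr)\quad\text{for all } k,l\in\mathbb{N},\ k\ne l.$$
   Context: A sequence $\{f_n\}_{n=1}^{\infty}$ in $\mathcal{H}$ is a Schauder basis if for every $x\in\mathcal{H}$ there exists a unique sequence $\{\alpha_n\}_{n=1}^{\infty}$ of complex numbers such that the partial sums $\sum_{n=1}^{k}\alpha_n f_n$ converge to $x$ in norm as $k\to\infty$. For such a basis, the $n$-th natural projection (partial sum operator) $Q_n$ is the operator sending $x=\sum_{j=1}^{\infty}\alpha_j f_j$ to $\sum_{j=1}^{n}\alpha_j f_j$; it is a bounded operator, and the basis constant is $M=\sup_{n}\|Q_n\|$, which is a finite number. The inner product of $\mathcal{H}$ is denoted $(\cdot,\cdot)$. *)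

theory Defs
  imports "HOL-Analysis.Analysis"
begin

text \<open>
  Complex inner product spaces, with the inner product linear in the first argument.
  The first assumption says that the real scalar multiplication carried by
  \<^class>\<open>real_normed_vector\<close> is the restriction of the complex one.
\<close>

class complex_inner = real_normed_vector +
  fixes scaleC :: "complex \<Rightarrow> 'a \<Rightarrow> 'a"  (infixr "*\<^sub>C" 75)
    and cinner :: "'a \<Rightarrow> 'a \<Rightarrow> complex"
  assumes scaleR_scaleC: "r *\<^sub>R x = complex_of_real r *\<^sub>C x"
    and scaleC_add_right: "a *\<^sub>C (x + y) = a *\<^sub>C x + a *\<^sub>C y"
    and scaleC_add_left: "(a + b) *\<^sub>C x = a *\<^sub>C x + b *\<^sub>C x"
    and scaleC_scaleC: "a *\<^sub>C (b *\<^sub>C x) = (a * b) *\<^sub>C x"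
    and scaleC_one: "1 *\<^sub>C x = x"
    and cinner_commute: "cinner x y = cnj (cinner y x)"
    and cinner_add_left: "cinner (x + y) z = cinner x z + cinner y z"
    and cinner_scaleC_left: "cinner (a *\<^sub>C x) y = a * cinner x y"
    and cinner_self: "cinner x x = complex_of_real ((norm x)\<^sup>2)"

class complex_hilbert_space = complex_inner + complete_space

subclass (in complex_hilbert_space) banach ..

text \<open>
  Sequences are indexed from 0, so \<open>f n\<close> is the vector \<open>f\<^bsub>n+1\<^esub>\<close> of the customary notation.
\<close>

definition schauder_basis :: "(nat \<Rightarrow> 'a::complex_inner) \<Rightarrow> bool" where
  "schauder_basis f \<longleftrightarrow>
     (\<forall>x. \<exists>!\<alpha>::nat \<Rightarrow> complex. (\<lambda>n. \<alpha> n *\<^sub>C f n) sums x)"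

definition basis_coeff :: "(nat \<Rightarrow> 'a::complex_inner) \<Rightarrow> 'a \<Rightarrow> nat \<Rightarrow> complex" where
  "basis_coeff f x = (THE \<alpha>. (\<lambda>n. \<alpha> n *\<^sub>C f n) sums x)"

text \<open>
  With indices from 0, the projection onto the first \<open>n + 1\<close> basis vectors.
\<close>

definition natural_projection :: "(nat \<Rightarrow> 'a::complex_inner) \<Rightarrow> nat \<Rightarrow> 'a \<Rightarrow> 'a" where
  "natural_projection f n x = (\<Sum>j\<le>n. basis_coeff f x j *\<^sub>C f j)"

text \<open>
  For a Schauder basis of a Hilbert space the projections are uniformly bounded, so both the
  operator norms and their supremum are genuine suprema of bounded sets of reals.
\<close>

definition basis_constant :: "(nat \<Rightarrow> 'a::complex_inner) \<Rightarrow> real" where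
  "basis_constant f = (SUP n. onorm (natural_projection f n))"

definition vec_angle :: "'a::complex_inner \<Rightarrow> 'a \<Rightarrow> real" where
  "vec_angle x y = arccos (cmod (cinner x y) / (norm x * norm y))"

end

theory Submission
  imports Defs
begin

text \<open>
  The angle estimate is a computation in a plane once the natural projections \<open>Q\<^sub>n\<close> are known to
  satisfy \<open>\<parallel>Q\<^sub>n x\<parallel> \<le> M \<parallel>x\<parallel>\<close>. For \<open>k < l\<close> the projection \<open>Q\<^sub>k\<close> fixes \<open>f\<^sub>k\<close> and kills \<open>f\<^sub>l\<close>, so
  \<open>\<parallel>f\<^sub>k\<parallel> \<le> M \<parallel>f\<^sub>k - c f\<^sub>l\<parallel>\<close> for every scalar \<open>c\<close>. Choosing \<open>c\<close> such that \<open>c f\<^sub>l\<close> has the same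
  length as \<open>f\<^sub>k\<close> and its inner product with \<open>f\<^sub>k\<close> is nonnegative, the right-hand side squared is
  \<open>M\<^sup>2 \<parallel>f\<^sub>k\<parallel>\<^sup>2 (2 - 2 t)\<close>, where \<open>t\<close> is the cosine of the angle. Hence \<open>t \<le> 1 - 1 / (2 M\<^sup>2)\<close>,
  which is stronger than the required bound \<open>t \<le> 1 - 1 / (8 M\<^sup>2)\<close>
  (\<^emph>\<open>cosine_le\<close>, \<^emph>\<open>basis_cosine_le\<close>).

  The substance is that \<open>M\<close> is a genuine supremum, that is, that the projections are uniformly
  bounded; not even the continuity of a single \<open>Q\<^sub>n\<close> is evident, so the usual uniform boundedness
  principle does not apply. The classical argument renorms the space by \<open>sup\<^sub>n \<parallel>Q\<^sub>n x\<parallel>\<close>, proves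
  completeness of the new norm and invokes the bounded inverse theorem. Here the two steps are
  merged. By Baire's theorem, applied to the closures of the sets where \<open>sup\<^sub>n \<parallel>Q\<^sub>n x\<parallel> \<le> m\<close>, every
  \<open>x\<close> is approximated up to half its norm by some \<open>y\<close> with \<open>sup\<^sub>n \<parallel>Q\<^sub>n y\<parallel> \<le> C \<parallel>x\<parallel>\<close>
  (\<^emph>\<open>pointwise_bounded_imp_half_approximation\<close>). Iterating on the remainder gives
  \<open>x = \<Sum>\<^sub>k y\<^sub>k\<close> with \<open>sup\<^sub>n \<parallel>Q\<^sub>n y\<^sub>k\<parallel> \<le> C \<parallel>x\<parallel> / 2\<^sup>k\<close> (\<^emph>\<open>half_approximation_imp_series\<close>). Uniqueness
  of coefficients allows \<open>Q\<^sub>n\<close> to be applied to this series term by term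
  (\<^emph>\<open>natural_projection_sums\<close>), and so \<open>\<parallel>Q\<^sub>n x\<parallel> \<le> 2 C \<parallel>x\<parallel>\<close>.
\<close>

section \<open>Approximation by vectors with small images\<close>

text \<open>
  This is the Baire category half of the open mapping theorem. The maps \<open>T n\<close> need not be
  continuous, so the sets \<open>A m\<close> of vectors whose images all have norm at most \<open>m\<close> need not be
  closed; Baire's theorem says only that the closure of some \<open>A m\<close> contains a ball. Differences of
  elements of \<open>A m\<close> then approximate all vectors of small norm, and scaling treats the others.
\<close>
lemma pointwise_bounded_imp_half_approximation:
  fixes T :: "nat \<Rightarrow> 'a::banach \<Rightarrow> 'b::real_normed_vector"
  assumes lin: "\<And>n. linear (T n)"
    and bdd: "\<And>x. bounded (range (\<lambda>n. T n x))"
  shows "\<exists>C. \<forall>x. \<exists>y. norm (x - y) \<le> norm x / 2 \<and> (\<forall>n. norm (T n y) \<le> C * norm x)"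
proof -
  define A where "A m = {x. \<forall>n. norm (T n x) \<le> real m}" for m
  have cover: "(\<Union>m. closure (A m)) = UNIV"
  proof -
    have "\<exists>m. x \<in> A m" for x
    proof -
      obtain b where "\<And>n. norm (T n x) \<le> b"
        using bdd[of x] by (auto simp: bounded_iff)
      moreover obtain m where "b \<le> real m"
        using real_arch_simple by blast
      ultimately show ?thesis
        unfolding A_def by (auto intro: order_trans)
    qed
    then have "(\<Union>m. A m) = UNIV"
      by auto
    moreover have "(\<Union>m. A m) \<subseteq> (\<Union>m. closure (A m))"
      by (intro UN_mono closure_subset order_refl)
    ultimately show ?thesis
      by auto
  qed
  have "\<exists>m. interior (closure (A m)) \<noteq> {}"
  proof (rule ccontr)
    assume "\<not> ?thesis"
    then have "euclidean interior_of (\<Union>(range (\<lambda>m. closure (A m)))) = {}"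
      by (intro Baire_category_alt)
        (auto simp: completely_metrizable_space_euclidean)
    then show False
      using cover by simp
  qed
  then obtain m x0 where "x0 \<in> interior (closure (A m))"
    by auto
  then obtain r where r: "r > 0" and ball: "ball x0 r \<subseteq> closure (A m)"
    by (meson mem_interior)
  have "\<exists>y. norm (x - y) \<le> norm x / 2 \<and> (\<forall>n. norm (T n y) \<le> (4 * m / r) * norm x)" for x
  proof (cases "x = 0")
    case True
    then show ?thesis
      using linear_0[OF lin] by (intro exI[of _ 0]) simp
  next
    case False
    \<comment> \<open>The ball is open, so \<open>x\<close> is scaled to length \<open>r / 2\<close>. Errors of \<open>r / 8\<close> in each of \<open>u\<close> and
      \<open>v\<close> add up to half of that length.\<close>
    define t where "t = r / (2 * norm x)"
    have t: "t > 0"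
      using r False by (simp add: t_def)
    have tx: "t * norm x = r / 2"
      using False by (simp add: t_def)
    have "x0 \<in> closure (A m)" "x0 + t *\<^sub>R x \<in> closure (A m)"
      using ball r t tx by (auto simp: dist_norm subset_iff)
    then obtain u v where u: "u \<in> A m" "dist u (x0 + t *\<^sub>R x) < r / 8"
      and v: "v \<in> A m" "dist v x0 < r / 8"
      using r by (metis closure_approachable zero_less_divide_iff zero_less_numeral)
    define y where "y = (1 / t) *\<^sub>R (u - v)"
    have "t *\<^sub>R (x - y) = (v - x0) - (u - (x0 + t *\<^sub>R x))"
      using t by (simp add: y_def algebra_simps)
    then have "t * norm (x - y) = norm ((v - x0) - (u - (x0 + t *\<^sub>R x)))"
      using t by (metis abs_of_pos norm_scaleR)
    also have "\<dots> \<le> r / 8 + r / 8"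
      using u v norm_triangle_ineq4[of "v - x0" "u - (x0 + t *\<^sub>R x)"]
      by (simp add: dist_norm)
    also have "\<dots> = t * (norm x / 2)"
      using tx by simp
    finally have "norm (x - y) \<le> norm x / 2"
      using t by simp
    moreover have "norm (T n y) \<le> (4 * m / r) * norm x" for n
    proof -
      have "T n y = (1 / t) *\<^sub>R (T n u - T n v)"
        unfolding y_def by (simp add: linear_scale[OF lin] linear_diff[OF lin])
      then have "norm (T n y) = norm (T n u - T n v) / t"
        using t by simp
      also have "\<dots> \<le> (real m + real m) / t"
        using t u(1) v(1)
        by (intro divide_right_mono norm_triangle_le_diff add_mono) (auto simp: A_def)
      also have "\<dots> = (4 * m / r) * norm x"
        using r False by (simp add: t_def field_simps)
      finally show ?thesis .
    qed
    ultimately show ?thesis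
      by blast
  qed
  then show ?thesis
    by blast
qed

text \<open>
  Replacing \<open>x\<close> by the error of its approximation halves the norm each time, so the successive
  approximations sum to \<open>x\<close>.
\<close>
lemma half_approximation_imp_series:
  fixes T :: "'i \<Rightarrow> 'a::real_normed_vector \<Rightarrow> 'b::real_normed_vector"
  assumes half: "\<And>x. \<exists>y. norm (x - y) \<le> norm x / 2 \<and> (\<forall>i. norm (T i y) \<le> C * norm x)"
    and C: "C \<ge> 0"
  shows "\<exists>y. y sums x \<and> (\<forall>i k. norm (T i (y k)) \<le> C * norm x * (1 / 2) ^ k)"
proof -
  obtain Y where Y: "\<And>x. norm (x - Y x) \<le> norm x / 2"
    and TY: "\<And>i x. norm (T i (Y x)) \<le> C * norm x"
    using half by metis
  define r where "r k = ((\<lambda>z. z - Y z) ^^ k) x" for k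
  have r_Suc: "r (Suc k) = r k - Y (r k)" for k
    by (simp add: r_def)
  have r_le: "norm (r k) \<le> norm x * (1 / 2) ^ k" for k
  proof (induction k)
    case 0
    then show ?case by (simp add: r_def)
  next
    case (Suc k)
    then show ?case
      using Y[of "r k"] by (simp add: r_Suc)
  qed
  have "r \<longlonglongrightarrow> 0"
  proof (rule Lim_null_comparison)
    show "\<forall>\<^sub>F k in sequentially. norm (r k) \<le> norm x * (1 / 2) ^ k"
      using r_le by (intro always_eventually allI)
    show "(\<lambda>k. norm x * (1 / 2) ^ k) \<longlonglongrightarrow> 0"
      by (intro tendsto_mult_right_zero LIMSEQ_power_zero) simp
  qed
  then have "(\<lambda>k. r k - r (Suc k)) sums (r 0 - 0)"
    by (rule telescope_sums')
  then have "(\<lambda>k. Y (r k)) sums x"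
    by (simp add: r_Suc) (simp add: r_def)
  moreover have "norm (T i (Y (r k))) \<le> C * norm x * (1 / 2) ^ k" for i k
    using TY[of i "r k"] mult_left_mono[OF r_le[of k] C] by (simp add: mult.assoc)
  ultimately show ?thesis
    by blast
qed

section \<open>Complex scalar multiplication\<close>

lemma cinner_scaleC_right: "cinner (x::'a::complex_inner) (a *\<^sub>C y) = cnj a * cinner x y"
  by (metis cinner_commute cinner_scaleC_left complex_cnj_mult)

lemma norm_scaleC: "norm (a *\<^sub>C (x::'a::complex_inner)) = cmod a * norm x"
proof -
  have "complex_of_real ((norm (a *\<^sub>C x))\<^sup>2) = a * cnj a * complex_of_real ((norm x)\<^sup>2)"
    by (simp only: cinner_self[symmetric] cinner_scaleC_left cinner_scaleC_right mult_ac)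
  also have "\<dots> = complex_of_real ((cmod a * norm x)\<^sup>2)"
    by (simp only: complex_norm_square power_mult_distrib of_real_mult)
  finally have "(norm (a *\<^sub>C x))\<^sup>2 = (cmod a * norm x)\<^sup>2"
    using of_real_eq_iff by blast
  then show ?thesis
    by (simp add: power2_eq_iff_nonneg)
qed

lemma bounded_linear_scaleC_left: "bounded_linear (\<lambda>a. a *\<^sub>C (x::'a::complex_inner))"
  by (rule bounded_linear_intro[where K = "norm x"])
    (simp_all add: scaleC_add_left scaleR_scaleC scaleC_scaleC scaleR_conv_of_real norm_scaleC)

lemma bounded_linear_scaleC_right: "bounded_linear (\<lambda>x::'a::complex_inner. a *\<^sub>C x)"
  by (rule bounded_linear_intro[where K = "cmod a"])
    (simp_all add: scaleC_add_right scaleR_scaleC scaleC_scaleC norm_scaleC mult.commute)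

lemma scaleC_zero_left: "0 *\<^sub>C (x::'a::complex_inner) = 0"
  using scaleR_scaleC[of 0 x] by simp

lemma scaleC_zero_right: "a *\<^sub>C (0::'a::complex_inner) = 0"
  using norm_scaleC[of a 0] by simp

lemma scaleC_minus_left: "(- a) *\<^sub>C (x::'a::complex_inner) = - (a *\<^sub>C x)"
  using scaleC_add_left[of a "- a" x] by (simp add: scaleC_zero_left add_eq_0_iff)

section \<open>Coefficients with respect to a Schauder basis\<close>

lemma basis_coeff_sums:
  assumes "schauder_basis f"
  shows "(\<lambda>n. basis_coeff f x n *\<^sub>C f n) sums x"
proof -
  have "\<exists>!\<alpha>. (\<lambda>n. \<alpha> n *\<^sub>C f n) sums x"
    using assms by (simp add: schauder_basis_def)
  from theI'[OF this] show ?thesis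
    unfolding basis_coeff_def .
qed

lemma basis_coeff_unique:
  assumes "schauder_basis f" and "(\<lambda>n. \<alpha> n *\<^sub>C f n) sums x"
  shows "basis_coeff f x = \<alpha>"
  unfolding basis_coeff_def
proof (rule the1_equality)
  show "\<exists>!\<alpha>. (\<lambda>n. \<alpha> n *\<^sub>C f n) sums x"
    using assms(1) by (simp add: schauder_basis_def)
qed (rule assms(2))

lemma basis_coeff_add:
  assumes "schauder_basis f"
  shows "basis_coeff f (x + y) = (\<lambda>n. basis_coeff f x n + basis_coeff f y n)"
  by (rule basis_coeff_unique[OF assms])
    (simp add: scaleC_add_left sums_add basis_coeff_sums[OF assms])

lemma basis_coeff_scaleC:
  assumes "schauder_basis f"
  shows "basis_coeff f (c *\<^sub>C x) = (\<lambda>n. c * basis_coeff f x n)"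
  by (rule basis_coeff_unique[OF assms])
    (simp add: scaleC_scaleC[symmetric] basis_coeff_sums[OF assms]
      bounded_linear.sums[OF bounded_linear_scaleC_right])

lemma basis_coeff_basis:
  assumes "schauder_basis f"
  shows "basis_coeff f (f k) = (\<lambda>n. if n = k then 1 else 0)"
proof (rule basis_coeff_unique[OF assms])
  have "(\<lambda>n. if n = k then f n else 0) sums f k"
    by (rule sums_single)
  moreover have "(if n = k then f n else 0) = (if n = k then 1 else 0) *\<^sub>C f n" for n
    by (simp add: scaleC_one scaleC_zero_left)
  ultimately show "(\<lambda>n. (if n = k then 1 else 0) *\<^sub>C f n) sums f k"
    by simp
qed

text \<open>If \<open>f k\<close> were zero, its \<open>k\<close>-th coefficient could be changed from 1 to 2.\<close>
lemma schauder_basis_nonzero: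
  assumes "schauder_basis f"
  shows "f k \<noteq> 0"
proof
  assume "f k = 0"
  then have "basis_coeff f (2 *\<^sub>C f k) = basis_coeff f (f k)"
    by (simp add: scaleC_zero_right)
  then show False
    by (auto simp: basis_coeff_scaleC[OF assms] basis_coeff_basis[OF assms] dest: fun_cong[of _ _ k])
qed

lemma linear_natural_projection:
  assumes "schauder_basis f"
  shows "linear (natural_projection f n)"
  by (rule linearI)
    (simp_all add: natural_projection_def basis_coeff_add[OF assms] basis_coeff_scaleC[OF assms]
      scaleR_scaleC scaleC_add_left sum.distrib scaleC_scaleC[symmetric]
      linear_sum[OF bounded_linear.linear[OF bounded_linear_scaleC_right]])

lemma natural_projection_tendsto:
  assumes "schauder_basis f"
  shows "(\<lambda>n. natural_projection f n x) \<longlonglongrightarrow> x"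
  using basis_coeff_sums[OF assms, of x] by (simp add: natural_projection_def sums_def_le)

text \<open>The only property of the projections that the angle estimate uses besides their bound.\<close>
lemma natural_projection_diff_basis:
  assumes "schauder_basis f" and "k < l"
  shows "natural_projection f k (f k - c *\<^sub>C f l) = f k"
proof -
  interpret linear "natural_projection f k"
    by (rule linear_natural_projection[OF assms(1)])
  have "natural_projection f k (f k) = f k" "natural_projection f k (c *\<^sub>C f l) = 0"
    using assms(2)
    by (auto simp: scaleC_zero_left natural_projection_def basis_coeff_basis[OF assms(1)]
        basis_coeff_scaleC[OF assms(1)] scaleC_one if_distrib[of "\<lambda>a. a *\<^sub>C _"] cong: if_cong)
  then show ?thesis
    by (simp add: diff)
qed

section \<open>Uniform boundedness of the natural projections\<close>

text \<open>
  This replaces the completeness of the norm \<open>sup\<^sub>n \<parallel>Q\<^sub>n x\<parallel>\<close>. Consecutive projections differ by one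
  term of the expansion, so the \<open>j\<close>-th coefficients of the \<open>y k\<close> are absolutely summable; let \<open>b j\<close>
  be their sum. The partial sums of \<open>b j f j\<close> are \<open>\<Sum>k. Q\<^sub>n (y k)\<close>. The majorant \<open>g\<close> makes this series
  converge uniformly in \<open>n\<close>, so the limit \<open>n \<rightarrow> \<infinity>\<close> may be taken inside it and equals \<open>\<Sum>k. y k = x\<close>.
  By uniqueness the \<open>b j\<close> are the coefficients of \<open>x\<close>.
\<close>
lemma natural_projection_sums:
  fixes f :: "nat \<Rightarrow> 'a::complex_hilbert_space"
  assumes basis: "schauder_basis f"
    and y: "y sums x"
    and g: "summable g"
    and le: "\<And>n k. norm (natural_projection f n (y k)) \<le> g k"
  shows "(\<lambda>k. natural_projection f n (y k)) sums natural_projection f n x"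
proof -
  define a where "a j k = basis_coeff f (y k) j" for j k
  have proj: "natural_projection f n (y k) = (\<Sum>j\<le>n. a j k *\<^sub>C f j)" for n k
    by (simp add: natural_projection_def a_def)
  have term_le: "norm (a j k *\<^sub>C f j) \<le> 2 * g k" for j k
  proof (cases j)
    case 0
    then show ?thesis
      using le[of 0 k] norm_ge_zero[of "a 0 k *\<^sub>C f 0"] by (simp add: proj del: norm_ge_zero)
  next
    case (Suc i)
    then have "a j k *\<^sub>C f j = natural_projection f j (y k) - natural_projection f i (y k)"
      by (simp add: proj)
    then show ?thesis
      using le[of j k] le[of i k] norm_triangle_ineq4 by (smt (verit))
  qed
  have summable_a: "summable (a j)" for j
  proof (rule summable_comparison_test')
    show "summable (\<lambda>k. 2 * g k / norm (f j))"
      using g by (intro summable_divide summable_mult)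
    show "norm (a j k) \<le> 2 * g k / norm (f j)" for k
      using term_le[of j k] schauder_basis_nonzero[OF basis]
      by (simp add: norm_scaleC field_simps)
  qed
  define b where "b j = suminf (a j)" for j
  have "(\<lambda>k. a j k *\<^sub>C f j) sums (b j *\<^sub>C f j)" for j
    unfolding b_def
    by (intro bounded_linear.sums[OF bounded_linear_scaleC_left] summable_sums summable_a)
  then have limit: "(\<lambda>k. natural_projection f n (y k)) sums (\<Sum>j\<le>n. b j *\<^sub>C f j)" for n
    unfolding proj by (intro sums_sum)
  have "(\<lambda>n. \<Sum>k. natural_projection f n (y k)) \<longlonglongrightarrow> x"
  proof (rule swap_uniform_limit')
    show "\<forall>\<^sub>F N in sequentially. (\<lambda>n. \<Sum>k<N. natural_projection f n (y k)) \<longlonglongrightarrow> (\<Sum>k<N. y k)"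
      by (intro always_eventually allI tendsto_sum natural_projection_tendsto[OF basis])
    show "(\<lambda>N. \<Sum>k<N. y k) \<longlonglongrightarrow> x"
      using y by (simp add: sums_def)
    show "uniform_limit UNIV (\<lambda>N n. \<Sum>k<N. natural_projection f n (y k))
        (\<lambda>n. \<Sum>k. natural_projection f n (y k)) sequentially"
      using le g by (intro Weierstrass_m_test)
  qed auto
  then have "(\<lambda>j. b j *\<^sub>C f j) sums x"
    using limit[THEN sums_unique] by (simp add: sums_def_le)
  then have "basis_coeff f x = b"
    by (rule basis_coeff_unique[OF basis])
  then show ?thesis
    using limit by (simp add: natural_projection_def)
qed

theorem natural_projections_uniformly_bounded:
  fixes f :: "nat \<Rightarrow> 'a::complex_hilbert_space"
  assumes basis: "schauder_basis f"
  obtains K where "\<And>n x. norm (natural_projection f n x) \<le> K * norm x"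
proof -
  have bdd: "bounded (range (\<lambda>n. natural_projection f n x))" for x
    using natural_projection_tendsto[OF basis] by (blast intro: convergent_imp_bounded)
  obtain C where half: "\<And>x. \<exists>y. norm (x - y) \<le> norm x / 2 \<and>
      (\<forall>n. norm (natural_projection f n y) \<le> C * norm x)"
    using pointwise_bounded_imp_half_approximation[OF linear_natural_projection[OF basis] bdd]
    by auto
  \<comment> \<open>The space contains a nonzero vector, which excludes a negative \<open>C\<close>.\<close>
  have C: "C \<ge> 0"
  proof -
    obtain y where "norm (natural_projection f 0 y) \<le> C * norm (f 0)"
      using half by blast
    then have "0 \<le> C * norm (f 0)"
      using norm_ge_zero order_trans by blast
    then show ?thesis
      using schauder_basis_nonzero[OF basis] by (simp add: zero_le_mult_iff)
  qed
  have "norm (natural_projection f n x) \<le> (2 * C) * norm x" for n x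
  proof -
    obtain y where y: "y sums x"
      and le: "\<And>n k. norm (natural_projection f n (y k)) \<le> C * norm x * (1 / 2) ^ k"
      using half_approximation_imp_series[OF half C, of x] by auto
    have geo: "(\<lambda>k. C * norm x * (1 / 2) ^ k) sums (C * norm x * 2)"
      using geometric_sums[of "1 / 2 :: real"] by (intro sums_mult) simp
    have "natural_projection f n x = (\<Sum>k. natural_projection f n (y k))"
      by (rule sums_unique[OF natural_projection_sums[OF basis y sums_summable[OF geo] le]])
    also have "norm \<dots> \<le> (\<Sum>k. C * norm x * (1 / 2) ^ k)"
      by (rule norm_suminf_le[OF le sums_summable[OF geo]])
    also have "\<dots> = (2 * C) * norm x"
      using sums_unique[OF geo] by simp
    finally show ?thesis .
  qed
  then show thesis
    using that by blast
qed

text \<open>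
  A supremum of reals is meaningful only for a set that is bounded above, and the operator norm only
  for a bounded operator; the uniform bound supplies both.
\<close>
lemma norm_natural_projection_le:
  fixes f :: "nat \<Rightarrow> 'a::complex_hilbert_space"
  assumes basis: "schauder_basis f"
  shows "norm (natural_projection f n x) \<le> basis_constant f * norm x"
proof -
  obtain K where K: "\<And>n x. norm (natural_projection f n x) \<le> K * norm x"
    using natural_projections_uniformly_bounded[OF basis] by blast
  have bl: "bounded_linear (natural_projection f n)" for n
    using linear_natural_projection[OF basis] K
    by (intro bounded_linear.intro bounded_linear_axioms.intro) (auto simp: mult.commute)
  have "0 \<le> K * norm (f 0)"
    using K[of 0 "f 0"] norm_ge_zero order_trans by blast
  then have "K \<ge> 0"
    using schauder_basis_nonzero[OF basis] by (simp add: zero_le_mult_iff)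
  then have "bdd_above (range (\<lambda>n. onorm (natural_projection f n)))"
    using K by (intro bdd_aboveI2[where M = K] onorm_bound)
  then have "onorm (natural_projection f n) \<le> basis_constant f"
    unfolding basis_constant_def by (intro cSUP_upper) auto
  then show ?thesis
    using onorm[OF bl, of n x] by (meson mult_right_mono norm_ge_zero order_trans)
qed

section \<open>The angle estimate\<close>

lemma norm_diff_scaleC_squared:
  fixes x y :: "'a::complex_inner"
  shows "(norm (x - c *\<^sub>C y))\<^sup>2 =
    (norm x)\<^sup>2 + (cmod c * norm y)\<^sup>2 - 2 * Re (cnj c * cinner x y)"
proof -
  have cinner_add_right: "cinner u (v + w) = cinner u v + cinner u w" for u v w :: 'a
    by (metis cinner_add_left cinner_commute complex_cnj_add)
  have "complex_of_real ((norm (x - c *\<^sub>C y))\<^sup>2) =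
      cinner (x + (- c) *\<^sub>C y) (x + (- c) *\<^sub>C y)"
    by (simp add: scaleC_minus_left cinner_self)
  also have "\<dots> = cinner x x + c * cnj c * cinner y y - (cnj c * cinner x y + c * cinner y x)"
    by (simp add: cinner_add_left cinner_add_right cinner_scaleC_left cinner_scaleC_right
        algebra_simps)
  also have "cnj c * cinner x y + c * cinner y x = complex_of_real (2 * Re (cnj c * cinner x y))"
    by (subst cinner_commute[of y x]) (metis complex_add_cnj complex_cnj_cnj complex_cnj_mult)
  finally have "complex_of_real ((norm (x - c *\<^sub>C y))\<^sup>2) =
      complex_of_real ((norm x)\<^sup>2 + (cmod c * norm y)\<^sup>2 - 2 * Re (cnj c * cinner x y))"
    by (simp only: cinner_self complex_norm_square power_mult_distrib of_real_mult of_real_add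
        of_real_diff)
  then show ?thesis
    using of_real_eq_iff by blast
qed

text \<open>
  The hypothesis says that the distance from \<open>x\<close> to the complex line through \<open>y\<close> is at least
  \<open>norm x / M\<close>. It is used for the vector of that line that has the same length as \<open>x\<close> and the
  largest real part of the inner product with \<open>x\<close>.
\<close>
lemma cosine_le:
  fixes x y :: "'a::complex_inner"
  assumes "x \<noteq> 0" "y \<noteq> 0" "M > 0"
    and le: "\<And>c. norm x \<le> M * norm (x - c *\<^sub>C y)"
  shows "cmod (cinner x y) / (norm x * norm y) \<le> 1 - 1 / (2 * M\<^sup>2)"
proof -
  obtain u where u: "cmod u = 1" "cnj u * cinner x y = cmod (cinner x y)"
  proof (cases "cinner x y = 0")
    case True
    then show thesis
      using that[of 1] by simp
  next
    case False
    show thesis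
    proof (rule that)
      show "cmod (sgn (cinner x y)) = 1"
        using False by (simp add: norm_sgn)
      show "cnj (sgn (cinner x y)) * cinner x y = cmod (cinner x y)"
        using False complex_norm_square[of "cinner x y"]
        by (simp add: sgn_eq field_simps power2_eq_square)
    qed
  qed
  define t where "t = cmod (cinner x y) / (norm x * norm y)"
  define c where "c = complex_of_real (norm x / norm y) * u"
  have "(norm x)\<^sup>2 \<le> M\<^sup>2 * (norm (x - c *\<^sub>C y))\<^sup>2"
    using power_mono[OF le[of c], of 2] by (simp add: power_mult_distrib)
  also have "(norm (x - c *\<^sub>C y))\<^sup>2 = (norm x)\<^sup>2 * (2 - 2 * t)"
  proof -
    have norm_cy: "cmod c * norm y = norm x"
      using u assms by (simp add: c_def norm_mult norm_divide)
    have "cnj c * cinner x y = complex_of_real (norm x / norm y * cmod (cinner x y))"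
      using u by (simp add: c_def mult.assoc)
    then have Re_eq: "Re (cnj c * cinner x y) = norm x / norm y * cmod (cinner x y)"
      by (simp only: Re_complex_of_real)
    show ?thesis
      unfolding norm_diff_scaleC_squared norm_cy Re_eq t_def
      using assms by (simp add: field_simps power2_eq_square)
  qed
  finally have "(norm x)\<^sup>2 * 1 \<le> (norm x)\<^sup>2 * (M\<^sup>2 * (2 - 2 * t))"
    by (simp add: mult_ac)
  then have "1 \<le> M\<^sup>2 * (2 - 2 * t)"
    by (rule mult_left_le_imp_le) (simp add: assms)
  then show ?thesis
    using assms unfolding t_def[symmetric] by (simp add: field_simps)
qed

lemma basis_constant_pos:
  fixes f :: "nat \<Rightarrow> 'a::complex_hilbert_space"
  assumes "schauder_basis f"
  shows "basis_constant f > 0"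
proof -
  have "norm (f 0) \<le> basis_constant f * norm (f 0 - 0 *\<^sub>C f 1)"
    using norm_natural_projection_le[OF assms, of 0 "f 0 - 0 *\<^sub>C f 1"]
    by (simp add: natural_projection_diff_basis[OF assms])
  then have "0 < basis_constant f * norm (f 0 - 0 *\<^sub>C f 1)"
    using schauder_basis_nonzero[OF assms, of 0] by (meson less_le_trans zero_less_norm_iff)
  then show ?thesis
    by (simp add: zero_less_mult_iff)
qed

text \<open>
  The cosine is symmetric, so the smaller index may be taken as that of the projection that
  separates the two vectors.
\<close>
lemma basis_cosine_le:
  fixes f :: "nat \<Rightarrow> 'a::complex_hilbert_space"
  assumes basis: "schauder_basis f" and "k \<noteq> l"
  shows "cmod (cinner (f k) (f l)) / (norm (f k) * norm (f l)) \<le>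
    1 - 1 / (2 * (basis_constant f)\<^sup>2)"
proof -
  have less: "cmod (cinner (f i) (f j)) / (norm (f i) * norm (f j)) \<le>
      1 - 1 / (2 * (basis_constant f)\<^sup>2)" if "i < j" for i j
  proof (intro cosine_le schauder_basis_nonzero basis basis_constant_pos)
    show "norm (f i) \<le> basis_constant f * norm (f i - c *\<^sub>C f j)" for c
      using norm_natural_projection_le[OF basis, of i "f i - c *\<^sub>C f j"]
      by (simp add: natural_projection_diff_basis[OF basis that])
  qed
  have "cmod (cinner (f l) (f k)) = cmod (cinner (f k) (f l))"
    by (metis cinner_commute complex_mod_cnj)
  then show ?thesis
    using less[of k l] less[of l k] \<open>k \<noteq> l\<close> by (auto simp: neq_iff mult.commute)
qed

theorem theorem2p1:
  fixes f :: "nat \<Rightarrow> 'a::complex_hilbert_space"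
  assumes separable: "separable_space (euclidean :: 'a topology)"
    and basis: "schauder_basis f"
  shows "(\<exists>\<theta>\<^sub>0>0. \<forall>k l. k \<noteq> l \<longrightarrow> vec_angle (f k) (f l) \<ge> \<theta>\<^sub>0) \<and>
    (\<forall>k l. k \<noteq> l \<longrightarrow>
       vec_angle (f k) (f l) \<ge> arccos (1 - 1 / (8 * (basis_constant f)\<^sup>2)))"
proof -
  define M where "M = basis_constant f"
  define s where "s = 1 - 1 / (8 * M\<^sup>2)"
  have M: "M > 0"
    using basis_constant_pos[OF basis] by (simp add: M_def)
  have cos_le: "cmod (cinner (f k) (f l)) / (norm (f k) * norm (f l)) \<le> s" if "k \<noteq> l" for k l
  proof -
    have "1 / (8 * M\<^sup>2) \<le> 1 / (2 * M\<^sup>2)"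
      using M by (intro divide_left_mono) auto
    then show ?thesis
      using basis_cosine_le[OF basis that] by (simp add: s_def M_def)
  qed
  \<comment> \<open>The function \<open>arccos\<close> is monotone only on \<open>[-1, 1]\<close>; the cosine of any one pair shows that
    \<open>s\<close> lies there.\<close>
  have "0 \<le> cmod (cinner (f 0) (f 1)) / (norm (f 0) * norm (f 1))"
    by simp
  then have "0 \<le> s"
    using cos_le[of 0 1] by linarith
  moreover have "s < 1"
    using M by (simp add: s_def)
  ultimately have "0 < arccos s"
    using arccos_less_arccos[of s 1] by simp
  moreover have "arccos s \<le> vec_angle (f k) (f l)" if "k \<noteq> l" for k l
    unfolding vec_angle_def
  proof (rule arccos_le_arccos)
    show "- 1 \<le> cmod (cinner (f k) (f l)) / (norm (f k) * norm (f l))"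
      by (rule order_trans[of _ 0]) auto
  qed (use cos_le[OF that] \<open>s < 1\<close> in auto)
  ultimately show ?thesis
    unfolding s_def M_def by blast
qed

end
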